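(* Let $S$ be a numerical semigroup. Let $K=\{k\in\mathbb{Z} \mid f(S)-k\notin S\}$ and let $\mathcal{D}(S)$ be the set of symmetric numerical semigroups $\overline{S}$ with $S=\frac{\overline{S}}{2}$. Then there exists a unique numerical semigroup with minimal genus among the members of $\mathcal{D}(S)$, and it is $S \Join^b K$, where $b$ is the minimum odd element of $S$ such that $K+K+b\subseteq S$. Its genus is $f(S)+\frac{b+1}{2}$.
   Context: $\mathbb{N}$ denotes the set of nonnegative integers. A numerical semigroup is a submonoid $S$ of $(\mathbb{N},+)$ (so $0\in S$) such that $\mathbb{N}\setminus S$ is finite. The genus $g(S)$ is the cardinality of $\mathbb{N}\setminus S$, and the Frobenius number $f(S)$ is the largest integer not belonging to $S$. The quotient $\frac{T}{2}$ of a numerical semigroup $T$ is $\{s\in\mathbb{N} \mid 2s\in T\}$. The type of $S$ is the number of integers $x\in\mathbb{Z}\setminus S$ such that $x+s\in S$ for all $s\in S\setminus\{0\}$; $S$ is symmetric if it has type one. For $X\subseteq\mathbb{Z}$, $2\cdot X=\{2x \mid x\in X\}$; sums such as $K+K+b$ denote $\{k+k'+b \mid k,k'\in K\}$. For an odd element $b\in S$, the numerical duplication of $S$ with respect to $K$ and $b$ is $S\Join^b K = 2\cdot S\cup(2\cdot K+b)$. *)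

theory Defs
  imports "HOL-Library.Set_Algebras"
begin

text \<open>
  All subsets of the naturals are represented as sets of integers contained in \<open>\<nat>\<close>, since the
  Frobenius number, the type and the ideal \<open>K\<close> refer to integers.
\<close>

definition numerical_semigroup :: "int set \<Rightarrow> bool" where
  "numerical_semigroup S \<longleftrightarrow>
     S \<subseteq> \<nat> \<and> 0 \<in> S \<and> (\<forall>x\<in>S. \<forall>y\<in>S. x + y \<in> S) \<and> finite (\<nat> - S)"

definition genus :: "int set \<Rightarrow> nat" where
  "genus S = card (\<nat> - S)"

text \<open>The maximum is over all integers, so the Frobenius number of \<open>\<nat>\<close> is \<open>-1\<close>.\<close>

definition frobenius :: "int set \<Rightarrow> int" where
  "frobenius S = (GREATEST x. x \<notin> S)"

definition half :: "int set \<Rightarrow> int set" where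
  "half T = {s \<in> \<nat>. 2 * s \<in> T}"

definition semigroup_type :: "int set \<Rightarrow> nat" where
  "semigroup_type S = card {x. x \<notin> S \<and> (\<forall>s \<in> S - {0}. x + s \<in> S)}"

definition symmetric_semigroup :: "int set \<Rightarrow> bool" where
  "symmetric_semigroup S \<longleftrightarrow> numerical_semigroup S \<and> semigroup_type S = 1"

definition canonical_ideal :: "int set \<Rightarrow> int set" where
  "canonical_ideal S = {k. frobenius S - k \<notin> S}"

definition symmetric_doubles :: "int set \<Rightarrow> int set set" where
  "symmetric_doubles S = {T. symmetric_semigroup T \<and> S = half T}"

text \<open>
  In \<^theory>\<open>HOL-Library.Set_Algebras\<close>, \<open>a +o X\<close> and \<open>a *o X\<close> are the elementwise translate and
  multiple, and \<open>X + Y\<close> is the sumset.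
\<close>

definition numerical_duplication :: "int set \<Rightarrow> int \<Rightarrow> int set \<Rightarrow> int set" where
  "numerical_duplication S b K = (2 *o S) \<union> (b +o (2 *o K))"

definition admissible_shifts :: "int set \<Rightarrow> int set \<Rightarrow> int set" where
  "admissible_shifts S K = {b \<in> S. odd b \<and> b +o (K + K) \<subseteq> S}"

end

theory Submission
  imports Defs
begin

text \<open>
  Write \<open>f\<close> for the Frobenius number of \<open>S\<close>. A numerical semigroup \<open>T\<close> with Frobenius number \<open>F\<close>
  is symmetric exactly when the reflection \<open>x \<mapsto> F - x\<close> exchanges \<open>T\<close> with its complement
  (\<open>symmetric_semigroup_iff_reflection\<close>). Two consequences drive the proof.

  First, \<open>F\<close> is odd: otherwise the reflection would fix \<open>F div 2\<close>. So the reflection exchanges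
  even and odd integers, and the odd part of \<open>T\<close> is determined by its even part, that is, by \<open>half T\<close>
  and \<open>F\<close>. If \<open>half T = S\<close>, then an odd \<open>x = F - 2 * y\<close> lies in \<open>T\<close> iff \<open>y \<notin> S\<close>, that is,
  iff \<open>y = f - k\<close> with \<open>k\<close> in the canonical ideal \<open>K\<close>. Hence \<open>T\<close> is the numerical duplication
  of \<open>S\<close> with respect to \<open>K\<close> and \<open>b = F - 2 * f\<close>, and closure under addition says precisely
  that \<open>b\<close> is an admissible shift. Conversely, every admissible shift gives a symmetric double of
  \<open>S\<close>. So the symmetric doubles are parametrized by the admissible shifts
  (\<open>symmetric_doubles_eq_duplications\<close>).

  Secondly, the reflection maps the gaps of \<open>T\<close> in \<open>{0..F}\<close> bijectively to the non-gaps in that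
  interval, so the genus is \<open>(F + 1) div 2\<close>. For \<open>F = 2 * f + b\<close> this is \<open>f + (b + 1) div 2\<close>, which
  strictly increases with the odd number \<open>b\<close>: the least genus is attained at the least admissible
  shift and nowhere else.
\<close>

section \<open>The Frobenius number\<close>

lemma int_in_Nats_iff: "x \<in> \<nat> \<longleftrightarrow> 0 \<le> (x::int)"
  by (auto simp: Nats_altdef1)

lemma frobenius_eqI:
  assumes "f \<notin> S" and "\<And>x. f < x \<Longrightarrow> x \<in> S"
  shows "frobenius S = f"
  unfolding frobenius_def
  by (rule Greatest_equality) (use assms not_le in blast)+

lemma
  assumes "numerical_semigroup S"
  shows frobenius_notin: "frobenius S \<notin> S"
    and frobenius_less_imp_in: "frobenius S < x \<Longrightarrow> x \<in> S"
proof -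
  \<comment> \<open>Adjoining \<open>-1\<close>, the largest negative integer, makes the maximum exist and be right for
      \<open>S = \<nat>\<close> too.\<close>
  define f where "f = Max (insert (-1) (\<nat> - S))"
  have fin: "finite (insert (-1) (\<nat> - S))" and sub: "S \<subseteq> \<nat>"
    using assms by (auto simp: numerical_semigroup_def)
  have "f \<in> insert (-1) (\<nat> - S)"
    unfolding f_def by (rule Max_in) (use fin in auto)
  moreover have "(-1::int) \<notin> \<nat>"
    by (auto simp: int_in_Nats_iff)
  ultimately have 1: "f \<notin> S"
    using sub by auto
  have 2: "y \<in> S" if "f < y" for y
  proof (rule ccontr)
    assume "y \<notin> S"
    have "-1 \<le> f"
      unfolding f_def by (rule Max_ge) (use fin in auto)
    with that have "y \<in> \<nat>"
      by (auto simp: int_in_Nats_iff)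
    with \<open>y \<notin> S\<close> have "y \<le> f"
      unfolding f_def by (intro Max_ge) (use fin in auto)
    with that show False by simp
  qed
  have "frobenius S = f"
    by (rule frobenius_eqI) (use 1 2 in auto)
  with 1 2 show "frobenius S \<notin> S" and "frobenius S < x \<Longrightarrow> x \<in> S"
    by auto
qed

lemma numerical_semigroup_nonneg: "numerical_semigroup S \<Longrightarrow> x \<in> S \<Longrightarrow> 0 \<le> x"
  by (auto simp: numerical_semigroup_def int_in_Nats_iff)

lemma numerical_semigroup_add:
  "numerical_semigroup S \<Longrightarrow> x \<in> S \<Longrightarrow> y \<in> S \<Longrightarrow> x + y \<in> S"
  by (simp add: numerical_semigroup_def)

lemma numerical_semigroup_zero: "numerical_semigroup S \<Longrightarrow> 0 \<in> S"
  by (simp add: numerical_semigroup_def)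

lemma frobenius_ge_minus_one:
  assumes "numerical_semigroup S"
  shows "-1 \<le> frobenius S"
  using frobenius_less_imp_in[OF assms, of "-1"] numerical_semigroup_nonneg[OF assms, of "-1"]
  by force


section \<open>Symmetry as a reflection\<close>

text \<open>
  The Frobenius number \<open>F\<close> is always counted by the type. Suppose some \<open>x\<close> lies outside \<open>T\<close>
  together with its mirror image \<open>F - x\<close>. The largest such \<open>x\<close> is counted by the type as well: if
  \<open>x + s \<notin> T\<close> for a nonzero \<open>s \<in> T\<close>, then maximality puts \<open>F - x - s\<close> into \<open>T\<close>, hence also \<open>F - x\<close>.
  Conversely, if the reflection exchanges \<open>T\<close> with its complement, then a gap \<open>x \<noteq> F\<close> cannot be
  counted, because adding the nonzero element \<open>F - x\<close> of \<open>T\<close> leads to \<open>F\<close>.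
\<close>

lemma symmetric_semigroup_iff_reflection:
  assumes T: "numerical_semigroup T"
  shows "symmetric_semigroup T \<longleftrightarrow> (\<forall>x. x \<in> T \<longleftrightarrow> frobenius T - x \<notin> T)"
proof -
  define F where "F = frobenius T"
  define P where "P = {x. x \<notin> T \<and> (\<forall>s \<in> T - {0}. x + s \<in> T)}"
  have F: "F \<notin> T" "\<And>x. F < x \<Longrightarrow> x \<in> T"
    using frobenius_notin[OF T] frobenius_less_imp_in[OF T] by (auto simp: F_def)
  have "F \<in> P"
    using F numerical_semigroup_nonneg[OF T] by (force simp: P_def)
  hence "card P = 1 \<longleftrightarrow> P = {F}"
    by (auto simp: card_1_singleton_iff)
  also have "\<dots> \<longleftrightarrow> (\<forall>x. x \<in> T \<longleftrightarrow> F - x \<notin> T)"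
  proof
    assume P: "P = {F}"
    define Q where "Q = {x. x \<notin> T \<and> F - x \<notin> T}"
    have "Q = {}"
    proof (rule ccontr)
      assume "Q \<noteq> {}"
      have "Q \<subseteq> {0..F}"
        using F(2) by (force simp: Q_def)
      hence fin: "finite Q"
        by (rule finite_subset) simp
      define m where "m = Max Q"
      have "m \<in> Q"
        unfolding m_def using fin \<open>Q \<noteq> {}\<close> by (rule Max_in)
      hence m: "m \<notin> T" "F - m \<notin> T"
        by (auto simp: Q_def)
      have "m + s \<in> T" if s: "s \<in> T" "s \<noteq> 0" for s
      proof (rule ccontr)
        assume "m + s \<notin> T"
        have "0 < s"
          using numerical_semigroup_nonneg[OF T s(1)] s(2) by simp
        hence "m + s \<notin> Q"
          using Max_ge[OF fin, of "m + s"] by (auto simp: m_def)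
        with \<open>m + s \<notin> T\<close> have "F - (m + s) \<in> T"
          by (auto simp: Q_def)
        from numerical_semigroup_add[OF T this s(1)] m(2) show False
          by simp
      qed
      with m have "m \<in> P"
        by (auto simp: P_def)
      with P m(2) show False
        using numerical_semigroup_zero[OF T] by auto
    qed
    moreover have "F - x \<notin> T" if "x \<in> T" for x
      using numerical_semigroup_add[OF T that, of "F - x"] F(1) by auto
    ultimately show "\<forall>x. x \<in> T \<longleftrightarrow> F - x \<notin> T"
      by (auto simp: Q_def)
  next
    assume refl: "\<forall>x. x \<in> T \<longleftrightarrow> F - x \<notin> T"
    have "x = F" if "x \<in> P" for x
    proof (rule ccontr)
      assume "x \<noteq> F"
      have "F - x \<in> T"
        using refl[rule_format, of x] that by (auto simp: P_def)
      with \<open>x \<noteq> F\<close> have "F - x \<in> T - {0}" by simp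
      with that have "x + (F - x) \<in> T"
        unfolding P_def by blast
      with F(1) show False by simp
    qed
    with \<open>F \<in> P\<close> show "P = {F}" by blast
  qed
  finally show ?thesis
    using T by (simp add: symmetric_semigroup_def semigroup_type_def P_def F_def)
qed

lemma symmetric_semigroup_odd_frobenius:
  assumes "symmetric_semigroup T"
  shows "odd (frobenius T)"
proof
  assume "even (frobenius T)"
  then obtain y where "frobenius T = 2 * y" by blast
  moreover from assms have "y \<in> T \<longleftrightarrow> frobenius T - y \<notin> T"
    using symmetric_semigroup_iff_reflection by (auto simp: symmetric_semigroup_def)
  ultimately show False by simp
qed

text \<open>Reflection matches the gaps with the elements of \<open>T\<close> below the Frobenius number.\<close>

lemma genus_symmetric_semigroup:
  assumes sym: "symmetric_semigroup T"
  shows "2 * int (genus T) = frobenius T + 1"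
proof -
  define F where "F = frobenius T"
  have T: "numerical_semigroup T"
    using sym by (simp add: symmetric_semigroup_def)
  have refl: "x \<in> T \<longleftrightarrow> F - x \<notin> T" for x
    using sym symmetric_semigroup_iff_reflection[OF T] unfolding F_def by blast
  have gaps: "\<nat> - T = {0..F} - T"
    using frobenius_less_imp_in[OF T] by (force simp: F_def int_in_Nats_iff)
  have "bij_betw (\<lambda>x. F - x) ({0..F} - T) ({0..F} \<inter> T)"
  proof (rule bij_betw_byWitness[where f' = "\<lambda>x. F - x"])
    show "(\<lambda>x. F - x) ` ({0..F} - T) \<subseteq> {0..F} \<inter> T"
    proof (rule image_subsetI)
      fix x assume "x \<in> {0..F} - T"
      thus "F - x \<in> {0..F} \<inter> T" using refl[of x] by auto
    qed
    show "(\<lambda>x. F - x) ` ({0..F} \<inter> T) \<subseteq> {0..F} - T"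
    proof (rule image_subsetI)
      fix x assume "x \<in> {0..F} \<inter> T"
      thus "F - x \<in> {0..F} - T" using refl[of x] by auto
    qed
  qed simp_all
  hence "card ({0..F} - T) = card ({0..F} \<inter> T)"
    by (rule bij_betw_same_card)
  moreover have "card {0..F} = card ({0..F} \<inter> T) + card ({0..F} - T)"
    by (rule card_Int_Diff) simp
  ultimately have "2 * genus T = nat (F + 1)"
    by (simp add: genus_def gaps)
  thus ?thesis
    using frobenius_ge_minus_one[OF T] by (simp add: F_def)
qed


section \<open>The canonical ideal and its duplications\<close>

lemma canonical_ideal_iff: "k \<in> canonical_ideal S \<longleftrightarrow> frobenius S - k \<notin> S"
  by (simp add: canonical_ideal_def)

lemma canonical_ideal_nonneg:
  assumes "numerical_semigroup S" and "k \<in> canonical_ideal S"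
  shows "0 \<le> k"
  using frobenius_less_imp_in[OF assms(1), of "frobenius S - k"] assms(2)
  by (force simp: canonical_ideal_iff)

lemma zero_in_canonical_ideal:
  "numerical_semigroup S \<Longrightarrow> 0 \<in> canonical_ideal S"
  by (simp add: canonical_ideal_iff frobenius_notin)

lemma canonical_ideal_add:
  assumes "numerical_semigroup S" and "s \<in> S" and "k \<in> canonical_ideal S"
  shows "s + k \<in> canonical_ideal S"
  using numerical_semigroup_add[OF assms(1,2), of "frobenius S - (s + k)"] assms(3)
  by (auto simp: canonical_ideal_iff)

lemma frobenius_less_imp_in_canonical_ideal:
  assumes "numerical_semigroup S" and "frobenius S < k"
  shows "k \<in> canonical_ideal S"
  using numerical_semigroup_nonneg[OF assms(1), of "frobenius S - k"] assms(2)
  by (force simp: canonical_ideal_iff)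

lemma admissible_shifts_iff:
  "b \<in> admissible_shifts S K \<longleftrightarrow>
    b \<in> S \<and> odd b \<and> (\<forall>k\<in>K. \<forall>l\<in>K. b + (k + l) \<in> S)"
  by (force simp: admissible_shifts_def elt_set_plus_def set_plus_def)

lemma numerical_duplication_iff:
  "x \<in> numerical_duplication S b K \<longleftrightarrow> (\<exists>s\<in>S. x = 2 * s) \<or> (\<exists>k\<in>K. x = b + 2 * k)"
  by (auto simp: numerical_duplication_def elt_set_plus_def elt_set_times_def)

lemma even_in_numerical_duplication_iff:
  fixes b :: int
  assumes "odd b"
  shows "2 * s \<in> numerical_duplication S b K \<longleftrightarrow> s \<in> S"
proof -
  have "2 * s \<noteq> b + 2 * k" for k
    using assms by presburger
  thus ?thesis by (auto simp: numerical_duplication_iff)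
qed

lemma odd_in_numerical_duplication_iff:
  fixes b :: int
  assumes "odd b"
  shows "b + 2 * k \<in> numerical_duplication S b K \<longleftrightarrow> k \<in> K"
proof -
  have "b + 2 * k \<noteq> 2 * s" for s
    using assms by presburger
  thus ?thesis by (auto simp: numerical_duplication_iff)
qed

lemma half_numerical_duplication:
  assumes "numerical_semigroup S" and "odd b"
  shows "half (numerical_duplication S b K) = S"
  using assms even_in_numerical_duplication_iff[OF assms(2)]
  by (auto simp: half_def numerical_semigroup_def)

text \<open>
  Every sufficiently large odd number is admissible, because \<open>K\<close> consists of nonnegative integers.
  A least one exists because the shifts lie in \<open>S\<close> and so are nonnegative.
\<close>

lemma least_admissible_shift_exists:
  assumes S: "numerical_semigroup S"
  defines "A \<equiv> admissible_shifts S (canonical_ideal S)"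
  shows "\<exists>b\<in>A. \<forall>b'\<in>A. b \<le> b'"
proof -
  \<comment> \<open>Writing \<open>c\<close> in terms of \<open>f + 1 \<ge> 0\<close> makes it an odd number above \<open>f\<close> even for \<open>f = -1\<close>.\<close>
  define c where "c = 2 * (frobenius S + 1) + 1"
  have c: "frobenius S < c + d" if "0 \<le> d" for d
    using that frobenius_ge_minus_one[OF S] by (simp add: c_def)
  have "c + (k + l) \<in> S" if "k \<in> canonical_ideal S" "l \<in> canonical_ideal S" for k l
    using that by (intro frobenius_less_imp_in[OF S] c add_nonneg_nonneg canonical_ideal_nonneg[OF S])
  moreover have "c \<in> S"
    using c[of 0] by (intro frobenius_less_imp_in[OF S]) simp
  moreover have "odd c"
    by (simp add: c_def)
  ultimately have "c \<in> A"
    by (simp add: A_def admissible_shifts_iff)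
  moreover have nonneg: "0 \<le> b" if "b \<in> A" for b
    using that numerical_semigroup_nonneg[OF S] by (auto simp: A_def admissible_shifts_iff)
  ultimately obtain b where "b \<in> A" "\<And>b'. b' \<in> A \<Longrightarrow> nat b \<le> nat b'"
    using ex_has_least_nat[of "\<lambda>b. b \<in> A" c nat] by blast
  thus ?thesis
    using nonneg by (intro bexI[of _ b] ballI) (auto simp: nat_le_eq_zle)
qed

context
  fixes S :: "int set" and b :: int
  assumes S: "numerical_semigroup S"
    and b: "b \<in> admissible_shifts S (canonical_ideal S)"
begin

lemma numerical_duplication_contains_large:
  assumes x: "2 * frobenius S + b < x"
  shows "x \<in> numerical_duplication S b (canonical_ideal S)"
proof -
  have odd: "odd b" and pos: "0 \<le> b"
    using b numerical_semigroup_nonneg[OF S] by (auto simp: admissible_shifts_iff)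
  show ?thesis
  proof (cases "even x")
    case True
    then obtain y where y: "x = 2 * y" by blast
    with x pos have "y \<in> S"
      by (intro frobenius_less_imp_in[OF S]) simp
    with y show ?thesis
      using even_in_numerical_duplication_iff[OF odd] by simp
  next
    case False
    with odd have "even (x - b)" by simp
    then obtain y where "x - b = 2 * y" by blast
    hence y: "x = b + 2 * y" by simp
    with x have "y \<in> canonical_ideal S"
      by (intro frobenius_less_imp_in_canonical_ideal[OF S]) simp
    with y show ?thesis
      using odd_in_numerical_duplication_iff[OF odd] by simp
  qed
qed

lemma frobenius_numerical_duplication:
  "frobenius (numerical_duplication S b (canonical_ideal S)) = 2 * frobenius S + b"
proof (rule frobenius_eqI)
  have odd: "odd b"
    using b by (simp add: admissible_shifts_iff)
  have "frobenius S \<notin> canonical_ideal S"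
    using numerical_semigroup_zero[OF S] by (simp add: canonical_ideal_iff)
  thus "2 * frobenius S + b \<notin> numerical_duplication S b (canonical_ideal S)"
    using odd_in_numerical_duplication_iff[OF odd] by (simp add: add.commute)
qed (rule numerical_duplication_contains_large)

text \<open>
  Even plus odd stays inside because \<open>K\<close> absorbs elements of \<open>S\<close>; odd plus odd equals
  \<open>2 * (b + (k + l))\<close>, which is where admissibility of \<open>b\<close> enters.
\<close>

lemma numerical_semigroup_numerical_duplication:
  "numerical_semigroup (numerical_duplication S b (canonical_ideal S))"
proof -
  let ?K = "canonical_ideal S"
  let ?D = "numerical_duplication S b ?K"
  have odd: "odd b" and pos: "0 \<le> b" and KK: "\<And>k l. k \<in> ?K \<Longrightarrow> l \<in> ?K \<Longrightarrow> b + (k + l) \<in> S"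
    using b numerical_semigroup_nonneg[OF S] by (auto simp: admissible_shifts_iff)
  have even: "2 * s \<in> ?D \<longleftrightarrow> s \<in> S" and odd': "b + 2 * k \<in> ?D \<longleftrightarrow> k \<in> ?K" for s k
    using even_in_numerical_duplication_iff[OF odd] odd_in_numerical_duplication_iff[OF odd]
    by auto
  have nonneg: "0 \<le> x" if "x \<in> ?D" for x
    using that pos numerical_semigroup_nonneg[OF S] canonical_ideal_nonneg[OF S]
    by (force simp: numerical_duplication_iff)
  have mixed: "2 * s + (b + 2 * k) \<in> ?D" if "s \<in> S" "k \<in> ?K" for s k
    using odd'[of "s + k"] canonical_ideal_add[OF S that] by (simp add: algebra_simps)
  have add: "x + y \<in> ?D" if xy: "x \<in> ?D" "y \<in> ?D" for x y
  proof -
    consider s t where "s \<in> S" "t \<in> S" "x = 2 * s" "y = 2 * t"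
      | s k where "s \<in> S" "k \<in> ?K" "x = 2 * s" "y = b + 2 * k"
      | s k where "s \<in> S" "k \<in> ?K" "y = 2 * s" "x = b + 2 * k"
      | k l where "k \<in> ?K" "l \<in> ?K" "x = b + 2 * k" "y = b + 2 * l"
      using xy unfolding numerical_duplication_iff by blast
    thus ?thesis
    proof cases
      case 1
      thus ?thesis
        using even[of "s + t"] numerical_semigroup_add[OF S] by simp
    next
      case 2
      thus ?thesis using mixed by simp
    next
      case 3
      thus ?thesis using mixed[of s k] by (simp add: add.commute)
    next
      case 4
      thus ?thesis
        using even[of "b + (k + l)"] KK by (simp add: algebra_simps)
    qed
  qed
  have "\<nat> - ?D \<subseteq> {0..2 * frobenius S + b}"
    using numerical_duplication_contains_large by (force simp: int_in_Nats_iff)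
  hence "finite (\<nat> - ?D)"
    by (rule finite_subset) simp
  moreover have "?D \<subseteq> \<nat>"
    using nonneg by (auto simp: int_in_Nats_iff)
  moreover have "0 \<in> ?D"
    using even[of 0] numerical_semigroup_zero[OF S] by simp
  ultimately show ?thesis
    using add by (simp add: numerical_semigroup_def)
qed

text \<open>
  The reflection at \<open>2 * f + b\<close> sends \<open>b + 2 * k\<close> to \<open>2 * (f - k)\<close>, and \<open>k\<close> lies in the canonical
  ideal exactly when \<open>f - k\<close> lies outside \<open>S\<close>.
\<close>

lemma symmetric_semigroup_numerical_duplication:
  "symmetric_semigroup (numerical_duplication S b (canonical_ideal S))"
proof -
  let ?K = "canonical_ideal S"
  let ?D = "numerical_duplication S b ?K"
  have odd: "odd b"
    using b by (simp add: admissible_shifts_iff)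
  have even: "2 * s \<in> ?D \<longleftrightarrow> s \<in> S" and odd': "b + 2 * k \<in> ?D \<longleftrightarrow> k \<in> ?K" for s k
    using even_in_numerical_duplication_iff[OF odd] odd_in_numerical_duplication_iff[OF odd]
    by auto
  have "x \<in> ?D \<longleftrightarrow> 2 * frobenius S + b - x \<notin> ?D" for x
  proof (cases "even x")
    case True
    then obtain s where x: "x = 2 * s" by blast
    hence "2 * frobenius S + b - x = b + 2 * (frobenius S - s)" by simp
    with x show ?thesis
      by (simp only: even odd' canonical_ideal_iff) simp
  next
    case False
    with odd have "even (x - b)" by simp
    then obtain k where "x - b = 2 * k" by blast
    hence x: "x = b + 2 * k" by simp
    hence "2 * frobenius S + b - x = 2 * (frobenius S - k)" by simp
    with x show ?thesis
      by (simp only: even odd' canonical_ideal_iff)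
  qed
  thus ?thesis
    unfolding symmetric_semigroup_iff_reflection[OF numerical_semigroup_numerical_duplication]
      frobenius_numerical_duplication
    by blast
qed

lemma genus_numerical_duplication:
  "int (genus (numerical_duplication S b (canonical_ideal S))) = frobenius S + (b + 1) div 2"
  using genus_symmetric_semigroup[OF symmetric_semigroup_numerical_duplication]
  by (simp add: frobenius_numerical_duplication)

end


section \<open>Parametrization of the symmetric doubles\<close>

lemma symmetric_double_is_duplication:
  assumes sym: "symmetric_semigroup T"
  defines "S \<equiv> half T"
  defines "b \<equiv> frobenius T - 2 * frobenius S"
  assumes S: "numerical_semigroup S"
  shows "T = numerical_duplication S b (canonical_ideal S)"
    and "b \<in> admissible_shifts S (canonical_ideal S)"
proof -
  let ?K = "canonical_ideal S"
  have T: "numerical_semigroup T"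
    using sym by (simp add: symmetric_semigroup_def)
  have refl: "x \<in> T \<longleftrightarrow> frobenius T - x \<notin> T" for x
    using sym symmetric_semigroup_iff_reflection[OF T] by blast
  have odd: "odd b"
    using symmetric_semigroup_odd_frobenius[OF sym] by (simp add: b_def)
  have even_iff: "2 * s \<in> T \<longleftrightarrow> s \<in> S" for s
    using numerical_semigroup_nonneg[OF T, of "2 * s"] by (auto simp: S_def half_def int_in_Nats_iff)
  have odd_iff: "b + 2 * k \<in> T \<longleftrightarrow> k \<in> ?K" for k
  proof -
    have "frobenius T - (b + 2 * k) = 2 * (frobenius S - k)"
      by (simp add: b_def)
    with refl[of "b + 2 * k"] show ?thesis
      by (simp only: even_iff canonical_ideal_iff)
  qed
  show "T = numerical_duplication S b ?K"
  proof (rule set_eqI)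
    fix x
    show "x \<in> T \<longleftrightarrow> x \<in> numerical_duplication S b ?K"
    proof (cases "even x")
      case True
      then obtain s where "x = 2 * s" by blast
      thus ?thesis
        by (simp add: even_iff even_in_numerical_duplication_iff[OF odd])
    next
      case False
      with odd have "even (x - b)" by simp
      then obtain k where "x - b = 2 * k" by blast
      hence "x = b + 2 * k" by simp
      thus ?thesis
        by (simp add: odd_iff odd_in_numerical_duplication_iff[OF odd])
    qed
  qed
  have KK: "b + (k + l) \<in> S" if "k \<in> ?K" "l \<in> ?K" for k l
  proof -
    have "b + 2 * k \<in> T" and "b + 2 * l \<in> T"
      using that odd_iff by blast+
    hence "(b + 2 * k) + (b + 2 * l) \<in> T"
      by (rule numerical_semigroup_add[OF T])
    moreover have "(b + 2 * k) + (b + 2 * l) = 2 * (b + (k + l))"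
      by simp
    ultimately show ?thesis
      using even_iff[of "b + (k + l)"] by metis
  qed
  \<comment> \<open>That \<open>b\<close> itself lies in \<open>S\<close> is the case \<open>k = l = 0\<close>.\<close>
  moreover have "b \<in> S"
    using KK[of 0 0] zero_in_canonical_ideal[OF S] by simp
  ultimately show "b \<in> admissible_shifts S ?K"
    using odd by (simp add: admissible_shifts_iff)
qed

lemma symmetric_doubles_eq_duplications:
  assumes S: "numerical_semigroup S"
  shows "symmetric_doubles S =
    (\<lambda>b. numerical_duplication S b (canonical_ideal S)) ` admissible_shifts S (canonical_ideal S)"
proof (intro equalityI subsetI)
  fix T assume "T \<in> symmetric_doubles S"
  hence "symmetric_semigroup T" "S = half T"
    by (auto simp: symmetric_doubles_def)
  with S symmetric_double_is_duplication[of T]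
  show "T \<in> (\<lambda>b. numerical_duplication S b (canonical_ideal S)) `
      admissible_shifts S (canonical_ideal S)"
    by blast
next
  fix T assume "T \<in> (\<lambda>b. numerical_duplication S b (canonical_ideal S)) `
      admissible_shifts S (canonical_ideal S)"
  thus "T \<in> symmetric_doubles S"
    using symmetric_semigroup_numerical_duplication[OF S] half_numerical_duplication[OF S]
    by (auto simp: symmetric_doubles_def admissible_shifts_iff)
qed

theorem proposition3p1:
  fixes S K :: "int set"
  assumes "numerical_semigroup S"
    and "K = canonical_ideal S"
  shows "\<exists>b. b \<in> admissible_shifts S K \<and> (\<forall>b' \<in> admissible_shifts S K. b \<le> b') \<and>
    (\<exists>!T. is_arg_min genus (\<lambda>T. T \<in> symmetric_doubles S) T) \<and>
    is_arg_min genus (\<lambda>T. T \<in> symmetric_doubles S) (numerical_duplication S b K) \<and>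
    int (genus (numerical_duplication S b K)) = frobenius S + (b + 1) div 2"
proof -
  let ?A = "admissible_shifts S K"
  let ?D = "\<lambda>b. numerical_duplication S b K"
  have doubles: "symmetric_doubles S = ?D ` ?A"
    using symmetric_doubles_eq_duplications assms by simp
  obtain b where b: "b \<in> ?A" and least: "\<And>b'. b' \<in> ?A \<Longrightarrow> b \<le> b'"
    using least_admissible_shift_exists assms by blast
  have genus: "int (genus (?D c)) = frobenius S + (c + 1) div 2" if "c \<in> ?A" for c
    using genus_numerical_duplication assms that by simp
  \<comment> \<open>Strictness uses that both shifts are odd, so that halving loses nothing.\<close>
  have less: "genus (?D b) < genus (?D c)" if c: "c \<in> ?A" and "c \<noteq> b" for c
  proof -
    have "odd b" "odd c" "b < c"
      using b c least[OF c] \<open>c \<noteq> b\<close> by (auto simp: admissible_shifts_iff)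
    hence "(b + 1) div 2 < (c + 1) div 2"
      by presburger
    thus ?thesis
      using genus[OF b] genus[OF c] by linarith
  qed
  have arg_min: "is_arg_min genus (\<lambda>T. T \<in> symmetric_doubles S) T \<longleftrightarrow> T = ?D b" for T
  proof
    assume "is_arg_min genus (\<lambda>T. T \<in> symmetric_doubles S) T"
    hence T: "T \<in> ?D ` ?A" and "\<not> genus (?D b) < genus T"
      using b unfolding is_arg_min_def doubles by blast+
    with less show "T = ?D b" by blast
  next
    assume T: "T = ?D b"
    have "\<not> genus (?D c) < genus (?D b)" if "c \<in> ?A" for c
      using less[OF that] by (cases "c = b") auto
    with b show "is_arg_min genus (\<lambda>T. T \<in> symmetric_doubles S) T"
      unfolding T is_arg_min_def doubles by blast
  qed
  show ?thesis
    using b least genus[OF b] by (intro exI[of _ b] conjI) (simp_all add: arg_min)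
qed

end
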